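(* Let the hypotheses $\mathcal H$ of the context hold and assume in addition that, for $\kappa\in\{A,B\}$, $r_\kappa\in C^1(\mathbb R)$, $r_\kappa'>0$ on $(0,+\infty)$, $r_\kappa(0)=0$ and $\limsup_{s\to0^+}\frac{s\,r_\kappa'(s)}{r_\kappa(s)}<\infty$. Then there exists a constant $C>0$, independent of the discretization $\mathcal D$ and of the reaction rate $k>0$, such that for every $k>0$ and every finite volume discretization $\mathcal D$ of $Q_T$ (see context), if $u_K^{(0)}=\frac1{m_K}\int_K u_0\,dx$, $v_K^{(0)}=\frac1{m_K}\int_K v_0\,dx$ for $K\in\mathcal M$ and $(u_K^{(n+1)},v_K^{(n+1)})_{K\in\mathcal M,\,n\in\{0,\dots,N\}}$ satisfies the finite volume scheme (S) of the context, then $$\sum_{n=0}^N t_\delta^{(n)}\Big(\sum_{(K,L)\in\mathcal E}T_{K|L}\big(u_L^{(n+1)}-u_K^{(n+1)}\big)^2+\sum_{(K,L)\in\mathcal E}T_{K|L}\big(v_L^{(n+1)}-v_K^{(n+1)}\big)^2\Big)\le C$$ and $$k\sum_{n=0}^N t_\delta^{(n)}\sum_{K\in\mathcal M}m_K\big(r_A(u_K^{(n+1)})-r_B(v_K^{(n+1)})\big)^2\le C.$$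
   Context: Hypotheses $\mathcal H$: (1) $\Omega\subset\mathbb R^d$, $d\in\{1,2,3\}$, is open, connected, bounded with smooth boundary; (2) $u_0,v_0\in L^\infty(\Omega)$ and there are constants $U,V>0$ with $0\le u_0\le U$, $0\le v_0\le V$ in $\Omega$; (3) $\alpha,\beta,a,b,k$ are strictly positive reals; (4) $r_A,r_B\in C^1(\mathbb R)$ are strictly increasing, $r_A(0)=r_B(0)=0$ and $r_A(\mathbb R^+)\subset r_B(\mathbb R^+)$. Also $T>0$ and $Q_T=\Omega\times(0,T)$. Notation: $\hat\alpha=k\alpha$, $\hat\beta=k\beta$. Discretization. An admissible mesh $\mathcal M$ of $\Omega$ is a (finite) set of open bounded subsets of $\Omega$ (control volumes), with one point $x_K$ for each $K\in\mathcal M$, such that: (i) the closure of the union of the control volumes is $\overline\Omega$; $m_K$ denotes the measure of $K$; (ii) $K\cap L=\emptyset$ for $K\ne L$ in $\mathcal M$, and if $\overline K\cap\overline L\neq\emptyset$ (with $K\neq L$) then it is a subset of a hyperplane of $\mathbb R^d$; $\mathcal E\subset\mathcal M^2$ is the set of pairs $(K,L)$ (with $K\ne L$) such that the $(d-1)$-dimensional Lebesgue measure of $\overline K\cap\overline L$ is strictly positive; for $(K,L)\in\mathcal E$ one writes $K|L=\overline K\cap\overline L$ and $m_{K|L}$ for its $(d-1)$-dimensional Lebesgue measure; (iii) with $\mathcal N_K=\{L\in\mathcal M:(K,L)\in\mathcal E\}$, $\partial K=\overline K\setminus K=(\overline K\cap\partial\Omega)\cup\bigcup_{L\in\mathcal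 N_K}K|L$; (iv) $x_K\in K$, and if $L\in\mathcal N_K$ the straight line $(x_K,x_L)$ is orthogonal to $K|L$; one sets $d_{K|L}=|x_K-x_L|$ and $T_{K|L}=m_{K|L}/d_{K|L}$. A time discretization of $(0,T)$ is an integer $N$ with a strictly increasing sequence $0=t^{(0)}<t^{(1)}<\dots<t^{(N+1)}=T$; $t_\delta^{(n)}=t^{(n+1)}-t^{(n)}$ for $n\in\{0,\dots,N\}$. A finite volume discretization $\mathcal D$ of $Q_T$ consists of an admissible mesh (with $\mathcal E$ and $(x_K)_{K\in\mathcal M}$) and a time discretization. Scheme (S): for all $K\in\mathcal M$ and $n\in\{0,\dots,N\}$, $$m_K(u_K^{(n+1)}-u_K^{(n)})-t_\delta^{(n)}a\sum_{L\in\mathcal N_K}T_{K|L}(u_L^{(n+1)}-u_K^{(n+1)})+t_\delta^{(n)}m_K\hat\alpha\big(r_A(u_K^{(n+1)})-r_B(v_K^{(n+1)})\big)=0,$$ $$m_K(v_K^{(n+1)}-v_K^{(n)})-t_\delta^{(n)}b\sum_{L\in\mathcal N_K}T_{K|L}(v_L^{(n+1)}-v_K^{(n+1)})-t_\delta^{(n)}m_K\hat\beta\big(r_A(u_K^{(n+1)})-r_B(v_K^{(n+1)})\big)=0.$$ *)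

theory Defs
  imports "HOL-Analysis.Analysis"
begin

text \<open>In finite dimension, \<open>C_diff m f\<close> says that all iterated directional derivatives of order at
  most \<open>m\<close> exist (as derivatives of differentiable functions) and are continuous.\<close>

primrec C_diff :: "nat \<Rightarrow> ('a::real_normed_vector \<Rightarrow> 'b::real_normed_vector) \<Rightarrow> bool" where
  "C_diff 0 f \<longleftrightarrow> continuous_on UNIV f"
| "C_diff (Suc m) f \<longleftrightarrow>
     (\<exists>f'. (\<forall>x. (f has_derivative f' x) (at x)) \<and> (\<forall>h. C_diff m (\<lambda>x. f' x h)))"

definition smooth :: "('a::real_normed_vector \<Rightarrow> 'b::real_normed_vector) \<Rightarrow> bool" where
  "smooth f \<longleftrightarrow> (\<forall>m. C_diff m f)"

text \<open>Near each boundary point the set is the strict subgraph, in some direction \<open>\<nu>\<close>, of a smooth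
  function of the coordinates orthogonal to \<open>\<nu>\<close>. To stay in one type, the function is defined on
  the whole space and evaluated at the orthogonal projection of \<open>y\<close> onto the complement of \<open>\<nu>\<close>.\<close>

definition smooth_boundary :: "'a::euclidean_space set \<Rightarrow> bool" where
  "smooth_boundary \<Omega> \<longleftrightarrow>
     (\<forall>x\<in>frontier \<Omega>. \<exists>\<nu> r. \<exists>\<gamma>::'a \<Rightarrow> real. norm \<nu> = 1 \<and> 0 < r \<and> smooth \<gamma> \<and>
        \<Omega> \<inter> ball x r = {y \<in> ball x r. y \<bullet> \<nu> < \<gamma> (y - (y \<bullet> \<nu>) *\<^sub>R \<nu>)})"

definition L_infty :: "'a::euclidean_space set \<Rightarrow> ('a \<Rightarrow> real) set" where
  "L_infty \<Omega> = {f \<in> borel_measurable (lebesgue_on \<Omega>). \<exists>B. AE x in lebesgue_on \<Omega>. \<bar>f x\<bar> \<le> B}"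

text \<open>Cartesian coordinates on a hyperplane through \<open>p\<close>: an isometry from
  $\mathbb{R}^{d-1}$ (functions on \<open>{..<d-1}\<close>) when \<open>e\<close> is orthonormal.\<close>

definition hyperplane_chart :: "real^'n \<Rightarrow> (nat \<Rightarrow> real^'n) \<Rightarrow> (nat \<Rightarrow> real) \<Rightarrow> real^'n" where
  "hyperplane_chart p e y = p + (\<Sum>i<CARD('n) - 1. y i *\<^sub>R e i)"

text \<open>The $(d-1)$-dimensional Lebesgue measure of a (bounded) subset of a hyperplane, computed in
  Cartesian coordinates. By invariance of Lebesgue measure under isometries the value does not
  depend on the chart chosen. For $d = 1$ the hyperplanes are the points, and a point has measure 1.
  The value is unspecified for sets not contained in a hyperplane.\<close>

definition hyperplane_measure :: "(real^'n) set \<Rightarrow> real" where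
  "hyperplane_measure S = (SOME m. \<exists>p e.
     (\<forall>i<CARD('n) - 1. \<forall>j<CARD('n) - 1. e i \<bullet> e j = (if i = j then 1 else 0)) \<and>
     S \<subseteq> range (hyperplane_chart p e) \<and>
     m = measure (Pi\<^sub>M {..<CARD('n) - 1} (\<lambda>_. lborel))
           {y \<in> space (Pi\<^sub>M {..<CARD('n) - 1} (\<lambda>_. lborel)). hyperplane_chart p e y \<in> S})"

definition interface :: "(real^'n) set \<Rightarrow> (real^'n) set \<Rightarrow> (real^'n) set" where
  "interface K L = closure K \<inter> closure L"

definition edges :: "(real^'n) set set \<Rightarrow> ((real^'n) set \<times> (real^'n) set) set" where
  "edges \<M> = {(K, L). K \<in> \<M> \<and> L \<in> \<M> \<and> K \<noteq> L \<and> 0 < hyperplane_measure (interface K L)}"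

definition neighbours :: "(real^'n) set set \<Rightarrow> (real^'n) set \<Rightarrow> (real^'n) set set" where
  "neighbours \<M> K = {L \<in> \<M>. (K, L) \<in> edges \<M>}"

definition transmissibility ::
  "((real^'n) set \<Rightarrow> real^'n) \<Rightarrow> (real^'n) set \<Rightarrow> (real^'n) set \<Rightarrow> real" where
  "transmissibility x K L = hyperplane_measure (interface K L) / dist (x K) (x L)"

definition admissible_mesh ::
  "(real^'n) set \<Rightarrow> (real^'n) set set \<Rightarrow> ((real^'n) set \<Rightarrow> real^'n) \<Rightarrow> bool" where
  "admissible_mesh \<Omega> \<M> x \<longleftrightarrow>
     finite \<M> \<and>
     (\<forall>K\<in>\<M>. open K \<and> bounded K \<and> K \<subseteq> \<Omega>) \<and>
     closure (\<Union>\<M>) = closure \<Omega> \<and>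
     (\<forall>K\<in>\<M>. \<forall>L\<in>\<M>. K \<noteq> L \<longrightarrow>
        K \<inter> L = {} \<and>
        (closure K \<inter> closure L \<noteq> {} \<longrightarrow>
           (\<exists>a c. a \<noteq> 0 \<and> closure K \<inter> closure L \<subseteq> {y. a \<bullet> y = c}))) \<and>
     (\<forall>K\<in>\<M>. closure K - K =
        (closure K \<inter> frontier \<Omega>) \<union> (\<Union>L\<in>neighbours \<M> K. interface K L)) \<and>
     (\<forall>K\<in>\<M>. x K \<in> K \<and>
        (\<forall>L\<in>neighbours \<M> K. \<forall>y\<in>interface K L. \<forall>z\<in>interface K L.
           orthogonal (x L - x K) (z - y)))"

definition time_discretization :: "real \<Rightarrow> nat \<Rightarrow> (nat \<Rightarrow> real) \<Rightarrow> bool" where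
  "time_discretization T N t \<longleftrightarrow> t 0 = 0 \<and> t (N + 1) = T \<and> (\<forall>n\<le>N. t n < t (n + 1))"

definition fv_discretization ::
  "(real^'n) set \<Rightarrow> real \<Rightarrow> (real^'n) set set \<Rightarrow> ((real^'n) set \<Rightarrow> real^'n) \<Rightarrow> nat \<Rightarrow> (nat \<Rightarrow> real) \<Rightarrow> bool"
  where
  "fv_discretization \<Omega> T \<M> x N t \<longleftrightarrow> admissible_mesh \<Omega> \<M> x \<and> time_discretization T N t"

definition cell_average :: "(real^'n \<Rightarrow> real) \<Rightarrow> (real^'n) set \<Rightarrow> real" where
  "cell_average f K = (1 / measure lebesgue K) * (LINT y:K|lebesgue. f y)"

text \<open>Here \<open>\<alpha>h\<close> and \<open>\<beta>h\<close> are the coefficients $\hat\alpha = k\alpha$ and $\hat\beta = k\beta$, and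
  \<open>u n K\<close> stands for $u_K^{(n)}$.\<close>

definition fv_scheme ::
  "real \<Rightarrow> real \<Rightarrow> real \<Rightarrow> real \<Rightarrow> (real \<Rightarrow> real) \<Rightarrow> (real \<Rightarrow> real) \<Rightarrow>
   (real^'n) set set \<Rightarrow> ((real^'n) set \<Rightarrow> real^'n) \<Rightarrow> nat \<Rightarrow> (nat \<Rightarrow> real) \<Rightarrow>
   (nat \<Rightarrow> (real^'n) set \<Rightarrow> real) \<Rightarrow> (nat \<Rightarrow> (real^'n) set \<Rightarrow> real) \<Rightarrow> bool" where
  "fv_scheme a b \<alpha>h \<beta>h rA rB \<M> x N t u v \<longleftrightarrow>
     (\<forall>K\<in>\<M>. \<forall>n\<le>N.
        measure lebesgue K * (u (n + 1) K - u n K)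
        - (t (n + 1) - t n) * a *
            (\<Sum>L\<in>neighbours \<M> K. transmissibility x K L * (u (n + 1) L - u (n + 1) K))
        + (t (n + 1) - t n) * measure lebesgue K * \<alpha>h * (rA (u (n + 1) K) - rB (v (n + 1) K)) = 0
      \<and>
        measure lebesgue K * (v (n + 1) K - v n K)
        - (t (n + 1) - t n) * b *
            (\<Sum>L\<in>neighbours \<M> K. transmissibility x K L * (v (n + 1) L - v (n + 1) K))
        - (t (n + 1) - t n) * measure lebesgue K * \<beta>h * (rA (u (n + 1) K) - rB (v (n + 1) K)) = 0)"

end

theory Submission
  imports Defs
begin

text \<open>The scheme is cooperative, hence satisfies a comparison principle. Comparing with the zero
  solution and with the spatially constant solution \<open>(P, Q)\<close> of the implicit Euler scheme started at
  \<open>(U, V)\<close>, which conserves \<open>\<beta> P + \<alpha> Q\<close>, gives $0 \le u, v \le M$ with \<open>M\<close> independent of \<open>k\<close> and of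
  the mesh. Then test the first equation with \<open>\<beta> \<phi>(u)\<close> and the second with \<open>\<alpha> \<psi>(v)\<close>, where
  \<open>\<phi> = r\<^sub>A + id + r\<^sub>B\<^sup>-\<^sup>1 \<circ> r\<^sub>A\<close> and \<open>\<psi> = r\<^sub>B + id + r\<^sub>A\<^sup>-\<^sup>1 \<circ> r\<^sub>B\<close> with inverses truncated to
  $[0, M]$. Both have slope at least 1, which controls the gradients, and each of the three pairs of
  summands has a reaction term of the right sign, the first pair giving the square of
  $r_A(u) - r_B(v)$. The time differences telescope into primitives of \<open>\<phi>\<close> and \<open>\<psi>\<close>.\<close>

section \<open>Convex primitives and generalised inverses of monotone functions\<close>

text \<open>The primitive of an increasing function is convex, with \<open>f y\<close> as a
  subgradient at \<open>y\<close>. Monotonicity already gives integrability, so jumps of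
  \<open>f\<close> are harmless.\<close>

lemma mono_on_primitive:
  fixes f :: "real \<Rightarrow> real"
  assumes f: "mono_on {0..M} f"
  obtains F where "F 0 = 0"
    "\<And>x y. x \<in> {0..M} \<Longrightarrow> y \<in> {0..M} \<Longrightarrow> F y - F x \<le> f y * (y - x)"
proof -
  define F where "F x = integral {0..x} f" for x
  have int: "f integrable_on {c..d}" if "0 \<le> c" "d \<le> M" for c d
    using that by (intro integrable_on_mono_on mono_on_subset[OF f]) auto
  have split: "F d = F c + integral {c..d} f" if "0 \<le> c" "c \<le> d" "d \<le> M" for c d
    unfolding F_def using that by (intro Henstock_Kurzweil_Integration.integral_combine[symmetric] int) auto
  have "F y - F x \<le> f y * (y - x)" if xy: "x \<in> {0..M}" "y \<in> {0..M}" for x y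
  proof (cases "x \<le> y")
    case True
    have "integral {x..y} f \<le> integral {x..y} (\<lambda>_. f y)"
      using xy by (intro integral_le int) (auto intro!: mono_onD[OF f])
    then show ?thesis using split[of x y] xy True by (simp add: mult.commute)
  next
    case False
    have "integral {y..x} (\<lambda>_. f y) \<le> integral {y..x} f"
      using xy by (intro integral_le int) (auto intro!: mono_onD[OF f])
    then show ?thesis using split[of y x] xy False by (simp add: algebra_simps)
  qed
  moreover have "F 0 = 0" by (simp add: F_def)
  ultimately show ?thesis using that by blast
qed

text \<open>For increasing \<open>r\<close> this is the inverse of \<open>r\<close> cut off at
  \<open>M\<close>. The supremum gives a value also where \<open>y\<close> lies outside the range of
  \<open>r\<close>: every \<open>y\<close> above \<open>r M\<close> is sent to
  \<open>M\<close>.\<close>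

definition truncated_inverse :: "(real \<Rightarrow> real) \<Rightarrow> real \<Rightarrow> real \<Rightarrow> real" where
  "truncated_inverse r M y = Sup {s \<in> {0..M}. r s \<le> y}"

lemma truncated_inverse_mono:
  assumes "0 \<le> M" "r 0 \<le> y" "y \<le> z"
  shows "truncated_inverse r M y \<le> truncated_inverse r M z"
  unfolding truncated_inverse_def
  using assms by (intro cSup_subset_mono) (auto intro!: exI[of _ 0] bdd_aboveI[of _ M])

lemma truncated_inverse_ge:
  assumes "s \<in> {0..M}" "r s \<le> y"
  shows "s \<le> truncated_inverse r M y"
  unfolding truncated_inverse_def
  using assms by (intro cSup_upper) (auto intro!: bdd_aboveI[of _ M])

lemma truncated_inverse_le:
  assumes "0 \<le> M" "strict_mono r" "r 0 \<le> y" "y < r s"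
  shows "truncated_inverse r M y \<le> s"
  unfolding truncated_inverse_def
proof (rule cSup_least)
  fix z assume "z \<in> {s \<in> {0..M}. r s \<le> y}"
  then have "r z < r s" using assms(4) by auto
  then show "z \<le> s" using assms(2) by (simp add: strict_mono_less)
qed (use assms in \<open>auto intro!: exI[of _ 0]\<close>)

text \<open>The truncated inverse of \<open>y\<close> lies on the same side of \<open>s\<close> as
  \<open>y\<close> does of \<open>r s\<close>, so both factors have the same sign. The cut-off
  preserves this because \<open>s\<close> is at most \<open>M\<close>.\<close>

lemma truncated_inverse_compat:
  assumes "strict_mono r" "s \<in> {0..M}" "r 0 \<le> y"
  shows "0 \<le> (r s - y) * (s - truncated_inverse r M y)"
proof (cases "r s \<le> y")
  case True
  then show ?thesis using truncated_inverse_ge[OF assms(2)] by (intro mult_nonpos_nonpos) auto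
next
  case False
  then show ?thesis
    using truncated_inverse_le[of M r y s] assms by (intro mult_nonneg_nonneg) auto
qed

section \<open>Discrete integration by parts and test functions\<close>

text \<open>Exchanging \<open>K\<close> and \<open>L\<close> in the double sum moves the factor
  \<open>f K\<close> to \<open>- f L\<close>; averaging the two forms gives the difference. The
  division by 2 reflects that ordered pairs count each interface twice.\<close>

lemma summation_by_parts:
  fixes w :: "'k \<Rightarrow> 'k \<Rightarrow> real"
  assumes "\<And>K L. w K L = w L K"
  shows "(\<Sum>K\<in>S. f K * (\<Sum>L\<in>S. w K L * (g L - g K))) =
         - (\<Sum>K\<in>S. \<Sum>L\<in>S. w K L * (g L - g K) * (f L - f K)) / 2"
proof -
  define A where "A = (\<Sum>K\<in>S. \<Sum>L\<in>S. f K * (w K L * (g L - g K)))"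
  have "A = (\<Sum>L\<in>S. \<Sum>K\<in>S. f K * (w K L * (g L - g K)))"
    unfolding A_def by (rule sum.swap)
  also have "\<dots> = (\<Sum>K\<in>S. \<Sum>L\<in>S. - (f L * (w K L * (g L - g K))))"
    by (intro sum.cong refl) (simp add: assms algebra_simps)
  finally have "A + A = (\<Sum>K\<in>S. \<Sum>L\<in>S. - (f L * (w K L * (g L - g K))))
                      + (\<Sum>K\<in>S. \<Sum>L\<in>S. f K * (w K L * (g L - g K)))"
    unfolding A_def by simp
  also have "\<dots> = - (\<Sum>K\<in>S. \<Sum>L\<in>S. w K L * (g L - g K) * (f L - f K))"
    by (simp add: sum_negf[symmetric] sum.distrib[symmetric] algebra_simps)
  finally have "A = - (\<Sum>K\<in>S. \<Sum>L\<in>S. w K L * (g L - g K) * (f L - f K)) / 2"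
    by linarith
  then show ?thesis unfolding A_def by (simp only: sum_distrib_left)
qed

lemma test_functions:
  assumes mono: "strict_mono rA" "strict_mono rB" and zero: "rA 0 = 0" "rB 0 = 0" and "0 \<le> M"
  obtains \<phi> \<psi> :: "real \<Rightarrow> real"
  where "\<And>x y. x \<in> {0..M} \<Longrightarrow> y \<in> {0..M} \<Longrightarrow> (x - y)\<^sup>2 \<le> (x - y) * (\<phi> x - \<phi> y)"
    "\<And>x y. x \<in> {0..M} \<Longrightarrow> y \<in> {0..M} \<Longrightarrow> (x - y)\<^sup>2 \<le> (x - y) * (\<psi> x - \<psi> y)"
    "\<And>x y. x \<in> {0..M} \<Longrightarrow> y \<in> {0..M} \<Longrightarrow> (rA x - rB y)\<^sup>2 \<le> (rA x - rB y) * (\<phi> x - \<psi> y)"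
    "0 \<le> \<phi> 0" "0 \<le> \<psi> 0"
proof -
  define test where "test r q s = r s + s + truncated_inverse q M (r s)" for r q and s :: real
  have slope: "(x - y)\<^sup>2 \<le> (x - y) * (test r q x - test r q y)"
    if r: "strict_mono r" "r 0 = 0" "q 0 = 0" and xy: "x \<in> {0..M}" "y \<in> {0..M}" for r q x y
  proof -
    have le: "d - c \<le> test r q d - test r q c" if "0 \<le> c" "c \<le> d" for c d
      using truncated_inverse_mono[of M q "r c" "r d"] \<open>0 \<le> M\<close> that r
        strict_mono_less_eq[OF r(1), of c d] strict_mono_less_eq[OF r(1), of 0 c] by (simp add: test_def)
    show ?thesis
    proof (cases "x \<le> y")
      case True
      have "(y - x) * (y - x) \<le> (y - x) * (test r q y - test r q x)"
        using le[of x y] True xy by (intro mult_left_mono) auto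
      then show ?thesis by (simp add: power2_eq_square algebra_simps)
    next
      case False
      then show ?thesis
        using le[of y x] xy unfolding power2_eq_square by (intro mult_left_mono) auto
    qed
  qed
  have nonneg: "0 \<le> test r q 0" if "r 0 = 0" "q 0 = 0" for r q
    using truncated_inverse_ge[of 0 M q 0] that \<open>0 \<le> M\<close> by (simp add: test_def)
  \<comment> \<open>The pairing is crosswise: the identity in one test function is matched with the
    truncated inverse in the other, and each such pair contributes a nonnegative product.\<close>
  have react: "(rA x - rB y)\<^sup>2 \<le> (rA x - rB y) * (test rA rB x - test rB rA y)"
    if xy: "x \<in> {0..M}" "y \<in> {0..M}" for x y
  proof -
    have "0 \<le> rA x" "0 \<le> rB y"
      using strict_mono_less_eq[OF mono(1), of 0 x] strict_mono_less_eq[OF mono(2), of 0 y] zero xy by auto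
    then have "0 \<le> (rA x - rB y) * (x - truncated_inverse rA M (rB y))"
      "0 \<le> (rB y - rA x) * (y - truncated_inverse rB M (rA x))"
      using truncated_inverse_compat mono xy zero by auto
    then show ?thesis by (simp add: test_def power2_eq_square algebra_simps)
  qed
  show ?thesis
    using that[of "test rA rB" "test rB rA"] slope nonneg react mono zero by blast
qed

section \<open>The implicit scheme on a finite weighted graph\<close>

text \<open>The mesh enters only through the cell measures \<open>m\<close> and symmetric weights
  \<open>w\<close>. A weight 0 stands for cells that are not neighbours, so that all sums run over
  \<open>S\<close>.\<close>

locale reaction_diffusion =
  fixes S :: "'k set" and m :: "'k \<Rightarrow> real" and w :: "'k \<Rightarrow> 'k \<Rightarrow> real"
    and a b k \<alpha> \<beta> :: real and rA rB :: "real \<Rightarrow> real"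
  assumes finite_S: "finite S"
    and m_pos: "K \<in> S \<Longrightarrow> 0 < m K"
    and w_nonneg: "0 \<le> w K L" and w_sym: "w K L = w L K"
    and pos: "0 < a" "0 < b" "0 < k" "0 < \<alpha>" "0 < \<beta>"
    and rA_mono: "strict_mono rA" and rB_mono: "strict_mono rB"
    and rA_0: "rA 0 = 0" and rB_0: "rB 0 = 0"
    and rA_cont: "continuous_on UNIV rA" and rB_cont: "continuous_on UNIV rB"
begin

definition step :: "real \<Rightarrow> ('k \<Rightarrow> real) \<Rightarrow> ('k \<Rightarrow> real) \<Rightarrow> ('k \<Rightarrow> real) \<Rightarrow> ('k \<Rightarrow> real) \<Rightarrow> bool" where
  "step \<tau> u v u' v' \<longleftrightarrow>
     (\<forall>K\<in>S. m K * (u' K - u K) - \<tau> * a * (\<Sum>L\<in>S. w K L * (u' L - u' K))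
               + \<tau> * m K * (k * \<alpha>) * (rA (u' K) - rB (v' K)) = 0 \<and>
            m K * (v' K - v K) - \<tau> * b * (\<Sum>L\<in>S. w K L * (v' L - v' K))
               - \<tau> * m K * (k * \<beta>) * (rA (u' K) - rB (v' K)) = 0)"

text \<open>The reaction is cooperative, so testing the difference of two solutions with the indicators of
  its positive parts shows that the weighted $L^1$ norm of the positive parts does not increase.\<close>

lemma step_comparison:
  assumes "0 < \<tau>" and s1: "step \<tau> u v u' v'" and s2: "step \<tau> p q p' q'"
    and ini: "\<And>K. K \<in> S \<Longrightarrow> u K \<le> p K" "\<And>K. K \<in> S \<Longrightarrow> v K \<le> q K"
    and "K \<in> S"
  shows "u' K \<le> p' K \<and> v' K \<le> q' K"
proof -
  define x where "x K = u' K - p' K" for K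
  define y where "y K = v' K - q' K" for K
  define f where "f K = (if 0 < x K then 1 else 0 :: real)" for K
  define g where "g K = (if 0 < y K then 1 else 0 :: real)" for K
  define R where "R K = (rA (u' K) - rB (v' K)) - (rA (p' K) - rB (q' K))" for K
  define D where "D h K = (\<Sum>L\<in>S. w K L * (h L - h K))" for h :: "'k \<Rightarrow> real" and K
  have Dx: "D x K = D u' K - D p' K" and Dy: "D y K = D v' K - D q' K" for K
    by (simp_all add: D_def x_def y_def sum_subtractf[symmetric] algebra_simps)
  have ex: "m K * x K = m K * (u K - p K) + \<tau> * a * D x K - \<tau> * m K * (k * \<alpha>) * R K" if "K \<in> S" for K
    using that s1 s2 unfolding step_def D_def[symmetric] Dx R_def x_def
    by (auto dest!: bspec[where x=K] simp: algebra_simps)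
  have ey: "m K * y K = m K * (v K - q K) + \<tau> * b * D y K + \<tau> * m K * (k * \<beta>) * R K" if "K \<in> S" for K
    using that s1 s2 unfolding step_def D_def[symmetric] Dy R_def y_def
    by (auto dest!: bspec[where x=K] simp: algebra_simps)
  have fg: "0 \<le> f K" "0 \<le> g K" for K by (auto simp: f_def g_def)
  \<comment> \<open>If only \<open>x K\<close> is positive, \<open>rA\<close> has increased and
    \<open>rB\<close> has not, so \<open>R K\<close> is nonnegative; if only \<open>y K\<close> is
    positive, the signs are reversed. Otherwise \<open>f K = g K\<close>.\<close>
  have react: "0 \<le> R K * (f K - g K)" for K
    using strict_mono_less_eq[OF rA_mono] strict_mono_less_eq[OF rB_mono]
    by (auto simp: f_def g_def R_def x_def y_def not_less intro!: add_nonneg_nonneg)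
       (smt (verit, best))+
  \<comment> \<open>The weights \<open>\<beta>\<close> and \<open>\<alpha>\<close> give both
    reaction terms the same coefficient, so that they combine into
    \<open>R K * (f K - g K)\<close>.\<close>
  have loc: "m K * (\<beta> * (f K * x K) + \<alpha> * (g K * y K)) \<le>
      \<tau> * a * \<beta> * (f K * D x K) + \<tau> * b * \<alpha> * (g K * D y K)" if "K \<in> S" for K
  proof -
    have "m K * (\<beta> * (f K * x K) + \<alpha> * (g K * y K)) =
      \<beta> * f K * (m K * x K) + \<alpha> * g K * (m K * y K)" by (simp add: algebra_simps)
    also have "\<dots> = (m K * \<beta> * f K * (u K - p K) + m K * \<alpha> * g K * (v K - q K))
       + \<tau> * a * \<beta> * (f K * D x K) + \<tau> * b * \<alpha> * (g K * D y K)
       - \<tau> * m K * k * \<alpha> * \<beta> * (R K * (f K - g K))"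
      unfolding ex[OF that] ey[OF that] by (simp add: algebra_simps)
    also have "\<dots> \<le> 0 + \<tau> * a * \<beta> * (f K * D x K) + \<tau> * b * \<alpha> * (g K * D y K) - 0"
      using m_pos[OF that] pos fg[of K] ini[OF that] react[of K] \<open>0 < \<tau>\<close>
      by (intro diff_mono add_mono order_refl add_nonpos_nonpos mult_nonneg_nonpos)
         (auto intro!: mult_nonneg_nonneg)
    finally show ?thesis by simp
  qed
  \<comment> \<open>The indicator of positivity is a nondecreasing function of \<open>z\<close>, so
    after summation by parts every term has a sign.\<close>
  have diff: "(\<Sum>K\<in>S. h K * D z K) \<le> 0" if "\<And>K. h K = (if 0 < z K then 1 else 0)" for h z
  proof -
    have "0 \<le> (z L - z K) * (h L - h K)" for K L by (auto simp: that)
    then show ?thesis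
      unfolding D_def summation_by_parts[of w, OF w_sym]
      by (simp add: mult.assoc sum_nonneg w_nonneg)
  qed
  have nn: "0 \<le> m K * (\<beta> * (f K * x K) + \<alpha> * (g K * y K))" if "K \<in> S" for K
    using m_pos[OF that] pos by (auto simp: f_def g_def)
  have "(\<Sum>K\<in>S. m K * (\<beta> * (f K * x K) + \<alpha> * (g K * y K))) \<le>
     (\<Sum>K\<in>S. \<tau> * a * \<beta> * (f K * D x K) + \<tau> * b * \<alpha> * (g K * D y K))"
    by (intro sum_mono loc)
  also have "\<dots> = \<tau> * a * \<beta> * (\<Sum>K\<in>S. f K * D x K) + \<tau> * b * \<alpha> * (\<Sum>K\<in>S. g K * D y K)"
    by (simp add: sum.distrib sum_distrib_left)
  also have "\<dots> \<le> 0"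
    using diff[of f x] diff[of g y] pos \<open>0 < \<tau>\<close>
    by (intro add_nonpos_nonpos mult_nonneg_nonpos) (auto simp: f_def g_def)
  finally have "(\<Sum>K\<in>S. m K * (\<beta> * (f K * x K) + \<alpha> * (g K * y K))) = 0"
    by (intro antisym sum_nonneg nn)
  then have "m K * (\<beta> * (f K * x K) + \<alpha> * (g K * y K)) = 0"
    using sum_nonneg_eq_0_iff[OF finite_S nn] \<open>K \<in> S\<close> by auto
  moreover have "0 < \<beta> * (f K * x K) + \<alpha> * (g K * y K)" if "0 < x K \<or> 0 < y K"
    using that pos by (auto simp: f_def g_def add_pos_pos)
  ultimately have "\<not> (0 < x K \<or> 0 < y K)" using m_pos[OF \<open>K \<in> S\<close>] by force
  then show ?thesis by (auto simp: x_def y_def)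
qed

lemma step_zero: "step \<tau> (\<lambda>_. 0) (\<lambda>_. 0) (\<lambda>_. 0) (\<lambda>_. 0)"
  by (simp add: step_def rA_0 rB_0)

text \<open>Diffusion vanishes on constants. Conservation eliminates \<open>Q'\<close>, and the
  remaining scalar equation is solved by the intermediate value theorem on the interval where both
  components are nonnegative.\<close>

lemma step_const:
  assumes "0 < \<tau>" "0 \<le> P" "0 \<le> Q"
  obtains P' Q' where "0 \<le> P'" "0 \<le> Q'" "\<beta> * P' + \<alpha> * Q' = \<beta> * P + \<alpha> * Q"
    "step \<tau> (\<lambda>_. P) (\<lambda>_. Q) (\<lambda>_. P') (\<lambda>_. Q')"
proof -
  define c where "c = \<beta> * P + \<alpha> * Q"
  define q where "q p = (c - \<beta> * p) / \<alpha>" for p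
  \<comment> \<open>The residual of the first equation with the second component given by
    conservation. At \<open>p = 0\<close> the term \<open>rA p\<close> vanishes and at
    \<open>p = c / \<beta>\<close> the term \<open>rB (q p)\<close> does, which fixes the signs of
    \<open>h\<close> there.\<close>
  define h where "h p = p - P + \<tau> * (k * \<alpha>) * (rA p - rB (q p))" for p
  have c: "0 \<le> c" "P \<le> c / \<beta>" using assms pos by (auto simp: c_def field_simps)
  have rA_nn: "0 \<le> rA s" and rB_nn: "0 \<le> rB s" if "0 \<le> s" for s
    using strict_mono_less_eq[OF rA_mono, of 0 s] strict_mono_less_eq[OF rB_mono, of 0 s] that
    by (auto simp: rA_0 rB_0)
  have "continuous_on {0..c / \<beta>} h"
    unfolding h_def q_def
    by (intro continuous_intros continuous_on_compose2[OF rA_cont] continuous_on_compose2[OF rB_cont])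
       (use pos in auto)
  moreover have "h 0 \<le> 0"
  proof -
    have "0 \<le> \<tau> * (k * \<alpha>) * rB (q 0)"
      using assms pos c by (intro mult_nonneg_nonneg rB_nn) (auto simp: q_def)
    then show ?thesis using assms by (simp add: h_def rA_0)
  qed
  moreover have "0 \<le> h (c / \<beta>)"
    using assms pos c rA_nn[of "c / \<beta>"] by (simp add: h_def rB_0 q_def)
  ultimately obtain p where p: "0 \<le> p" "p \<le> c / \<beta>" "h p = 0"
    using IVT'[of h 0 0 "c / \<beta>"] c pos by (auto simp: field_simps)
  have qp: "\<alpha> * q p = c - \<beta> * p" using pos by (simp add: q_def)
  have "0 \<le> q p" using p pos by (simp add: q_def field_simps)
  moreover have "\<beta> * p + \<alpha> * q p = \<beta> * P + \<alpha> * Q" using qp by (simp add: c_def)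
  moreover have "step \<tau> (\<lambda>_. P) (\<lambda>_. Q) (\<lambda>_. p) (\<lambda>_. q p)"
  proof -
    have e1: "(p - P) + \<tau> * (k * \<alpha>) * (rA p - rB (q p)) = 0" using p(3) by (simp add: h_def)
    \<comment> \<open>By conservation the residuals of the two equations are proportional, so the
      second equation follows from the first.\<close>
    have "\<alpha> * ((q p - Q) - \<tau> * (k * \<beta>) * (rA p - rB (q p))) =
          - \<beta> * ((p - P) + \<tau> * (k * \<alpha>) * (rA p - rB (q p)))"
      using qp by (simp add: c_def algebra_simps)
    then have e2: "(q p - Q) - \<tau> * (k * \<beta>) * (rA p - rB (q p)) = 0" using e1 pos by simp
    have "m K * (p - P) + \<tau> * m K * (k * \<alpha>) * (rA p - rB (q p)) =
          m K * ((p - P) + \<tau> * (k * \<alpha>) * (rA p - rB (q p)))"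
         "m K * (q p - Q) - \<tau> * m K * (k * \<beta>) * (rA p - rB (q p)) =
          m K * ((q p - Q) - \<tau> * (k * \<beta>) * (rA p - rB (q p)))" for K
      by (simp_all add: algebra_simps)
    then show ?thesis unfolding step_def e1 e2 by simp
  qed
  ultimately show ?thesis using that[of p "q p"] p(1) by blast
qed

text \<open>Spatially constant solutions dominate inductively. One of \<open>P\<close>,
  \<open>Q\<close> may grow, but both stay nonnegative and \<open>\<beta> * P + \<alpha> * Q\<close>
  is conserved, which bounds each of them independently of \<open>k\<close> and the time
  steps.\<close>

lemma steps_bounded:
  fixes N :: nat
  assumes steps: "\<And>n. n \<le> N \<Longrightarrow> 0 < \<tau> n \<and> step (\<tau> n) (u n) (v n) (u (n + 1)) (v (n + 1))"
    and ini: "\<And>K. K \<in> S \<Longrightarrow> u 0 K \<in> {0..U} \<and> v 0 K \<in> {0..V}"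
    and UV: "0 \<le> U" "0 \<le> V" and "n \<le> N + 1" and "K \<in> S"
  shows "0 \<le> u n K \<and> \<beta> * u n K \<le> \<beta> * U + \<alpha> * V \<and> 0 \<le> v n K \<and> \<alpha> * v n K \<le> \<beta> * U + \<alpha> * V"
proof -
  from \<open>n \<le> N + 1\<close>
  have "\<exists>P Q. 0 \<le> P \<and> 0 \<le> Q \<and> \<beta> * P + \<alpha> * Q = \<beta> * U + \<alpha> * V \<and>
          (\<forall>K\<in>S. u n K \<in> {0..P} \<and> v n K \<in> {0..Q})"
  proof (induction n)
    case 0
    then show ?case using UV ini by blast
  next
    case (Suc n)
    then obtain P Q where PQ: "0 \<le> P" "0 \<le> Q" "\<beta> * P + \<alpha> * Q = \<beta> * U + \<alpha> * V"
      "\<And>K. K \<in> S \<Longrightarrow> u n K \<in> {0..P} \<and> v n K \<in> {0..Q}" by auto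
    have st: "0 < \<tau> n" "step (\<tau> n) (u n) (v n) (u (n + 1)) (v (n + 1))"
      using steps[of n] Suc.prems by auto
    obtain P' Q' where PQ': "0 \<le> P'" "0 \<le> Q'" "\<beta> * P' + \<alpha> * Q' = \<beta> * P + \<alpha> * Q"
      "step (\<tau> n) (\<lambda>_. P) (\<lambda>_. Q) (\<lambda>_. P') (\<lambda>_. Q')"
      using step_const[OF st(1) PQ(1,2)] by blast
    \<comment> \<open>Comparison is used twice: with the constant solution from above and with the
      zero solution from below.\<close>
    have "\<forall>K\<in>S. u (Suc n) K \<in> {0..P'} \<and> v (Suc n) K \<in> {0..Q'}"
      using step_comparison[OF st(1) st(2) PQ'(4)] step_comparison[OF st(1) step_zero st(2)] PQ(4)
      by auto
    then show ?case using PQ' PQ(3) by auto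
  qed
  then obtain P Q where "0 \<le> P" "0 \<le> Q" "\<beta> * P + \<alpha> * Q = \<beta> * U + \<alpha> * V"
      "u n K \<in> {0..P}" "v n K \<in> {0..Q}" using \<open>K \<in> S\<close> by blast
  moreover have "\<beta> * u n K \<le> \<beta> * P" "\<alpha> * v n K \<le> \<alpha> * Q" using calculation pos by auto
  moreover have "0 \<le> \<beta> * P" "0 \<le> \<alpha> * Q" using calculation pos by auto
  ultimately show ?thesis by auto
qed

text \<open>The square of a discrete \<open>H^1\<close> seminorm, with each interface counted in
  both orders.\<close>

definition energy :: "('k \<Rightarrow> real) \<Rightarrow> real" where
  "energy z = (\<Sum>K\<in>S. \<Sum>L\<in>S. w K L * (z L - z K)\<^sup>2)"

text \<open>One time step of the testing argument: reaction and diffusion are paid for by the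
  decrease of the convex functional built from \<open>\<Phi>\<close> and
  \<open>\<Psi>\<close>.\<close>

lemma step_energy:
  assumes "0 < \<tau>" and st: "step \<tau> u v u' v'"
    and \<Phi>: "\<And>x y. x \<in> {0..M} \<Longrightarrow> y \<in> {0..M} \<Longrightarrow> \<Phi> y - \<Phi> x \<le> \<phi> y * (y - x)"
    and \<Psi>: "\<And>x y. x \<in> {0..M} \<Longrightarrow> y \<in> {0..M} \<Longrightarrow> \<Psi> y - \<Psi> x \<le> \<psi> y * (y - x)"
    and \<phi>: "\<And>x y. x \<in> {0..M} \<Longrightarrow> y \<in> {0..M} \<Longrightarrow> (x - y)\<^sup>2 \<le> (x - y) * (\<phi> x - \<phi> y)"
    and \<psi>: "\<And>x y. x \<in> {0..M} \<Longrightarrow> y \<in> {0..M} \<Longrightarrow> (x - y)\<^sup>2 \<le> (x - y) * (\<psi> x - \<psi> y)"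
    and react: "\<And>x y. x \<in> {0..M} \<Longrightarrow> y \<in> {0..M} \<Longrightarrow> (rA x - rB y)\<^sup>2 \<le> (rA x - rB y) * (\<phi> x - \<psi> y)"
    and bd: "\<And>K. K \<in> S \<Longrightarrow> u K \<in> {0..M} \<and> v K \<in> {0..M} \<and> u' K \<in> {0..M} \<and> v' K \<in> {0..M}"
  shows "\<tau> * (\<beta> * a / 2 * energy u' + \<alpha> * b / 2 * energy v'
            + \<alpha> * \<beta> * k * (\<Sum>K\<in>S. m K * (rA (u' K) - rB (v' K))\<^sup>2))
         \<le> (\<Sum>K\<in>S. m K * (\<beta> * \<Phi> (u K) + \<alpha> * \<Psi> (v K)))
           - (\<Sum>K\<in>S. m K * (\<beta> * \<Phi> (u' K) + \<alpha> * \<Psi> (v' K)))"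
proof -
  define D where "D h K = (\<Sum>L\<in>S. w K L * (h L - h K))" for h :: "'k \<Rightarrow> real" and K
  have eu: "m K * (u' K - u K) = \<tau> * a * D u' K - \<tau> * m K * (k * \<alpha>) * (rA (u' K) - rB (v' K))"
   and ev: "m K * (v' K - v K) = \<tau> * b * D v' K + \<tau> * m K * (k * \<beta>) * (rA (u' K) - rB (v' K))"
    if "K \<in> S" for K
    using that st unfolding step_def D_def by (auto dest!: bspec[where x=K] simp: algebra_simps)
  have loc: "m K * (\<beta> * \<Phi> (u' K) + \<alpha> * \<Psi> (v' K)) - m K * (\<beta> * \<Phi> (u K) + \<alpha> * \<Psi> (v K)) \<le>
      \<tau> * \<beta> * a * (\<phi> (u' K) * D u' K) + \<tau> * \<alpha> * b * (\<psi> (v' K) * D v' K)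
      - \<tau> * \<alpha> * \<beta> * k * (m K * (rA (u' K) - rB (v' K))\<^sup>2)" (is "?l \<le> ?r") if K: "K \<in> S" for K
  proof -
    have "?l = m K * (\<beta> * (\<Phi> (u' K) - \<Phi> (u K)) + \<alpha> * (\<Psi> (v' K) - \<Psi> (v K)))"
      by (simp add: algebra_simps)
    \<comment> \<open>The scheme is implicit, so the test functions are taken at the new values,
      where the subgradient inequality bounds the increments of the primitives from above.\<close>
    also have "\<dots> \<le> m K * (\<beta> * (\<phi> (u' K) * (u' K - u K)) + \<alpha> * (\<psi> (v' K) * (v' K - v K)))"
      using m_pos[OF K] pos bd[OF K] by (intro mult_left_mono add_mono \<Phi> \<Psi>) auto
    also have "\<dots> = \<beta> * \<phi> (u' K) * (m K * (u' K - u K)) + \<alpha> * \<psi> (v' K) * (m K * (v' K - v K))"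
      by (simp add: algebra_simps)
    also have "\<dots> = \<tau> * \<beta> * a * (\<phi> (u' K) * D u' K) + \<tau> * \<alpha> * b * (\<psi> (v' K) * D v' K)
      - \<tau> * \<alpha> * \<beta> * k * (m K * ((rA (u' K) - rB (v' K)) * (\<phi> (u' K) - \<psi> (v' K))))"
      unfolding eu[OF K] ev[OF K] by (simp add: algebra_simps)
    also have "\<dots> \<le> ?r"
      using m_pos[OF K] pos bd[OF K] \<open>0 < \<tau>\<close>
      by (intro diff_mono order_refl mult_left_mono react) auto
    finally show ?thesis .
  qed
  have diff: "(\<Sum>K\<in>S. \<theta> (z K) * D z K) \<le> - energy z / 2"
    if "\<And>K L. K \<in> S \<Longrightarrow> L \<in> S \<Longrightarrow> (z L - z K)\<^sup>2 \<le> (z L - z K) * (\<theta> (z L) - \<theta> (z K))" for \<theta> z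
    unfolding D_def summation_by_parts[of w "\<lambda>K. \<theta> (z K)", OF w_sym] energy_def
    using that by (auto intro!: sum_mono mult_left_mono simp: w_nonneg mult.assoc)
  have "(\<Sum>K\<in>S. m K * (\<beta> * \<Phi> (u' K) + \<alpha> * \<Psi> (v' K))) - (\<Sum>K\<in>S. m K * (\<beta> * \<Phi> (u K) + \<alpha> * \<Psi> (v K)))
     \<le> (\<Sum>K\<in>S. \<tau> * \<beta> * a * (\<phi> (u' K) * D u' K) + \<tau> * \<alpha> * b * (\<psi> (v' K) * D v' K)
      - \<tau> * \<alpha> * \<beta> * k * (m K * (rA (u' K) - rB (v' K))\<^sup>2))"
    unfolding sum_subtractf[symmetric] by (intro sum_mono loc[unfolded sum_subtractf])
  also have "\<dots> = \<tau> * \<beta> * a * (\<Sum>K\<in>S. \<phi> (u' K) * D u' K) + \<tau> * \<alpha> * b * (\<Sum>K\<in>S. \<psi> (v' K) * D v' K)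
      - \<tau> * \<alpha> * \<beta> * k * (\<Sum>K\<in>S. m K * (rA (u' K) - rB (v' K))\<^sup>2)"
    by (simp add: sum.distrib sum_subtractf sum_distrib_left)
  also have "\<dots> \<le> \<tau> * \<beta> * a * (- energy u' / 2) + \<tau> * \<alpha> * b * (- energy v' / 2)
      - \<tau> * \<alpha> * \<beta> * k * (\<Sum>K\<in>S. m K * (rA (u' K) - rB (v' K))\<^sup>2)"
    using pos \<open>0 < \<tau>\<close> bd by (intro diff_mono add_mono order_refl mult_left_mono diff \<phi> \<psi>) auto
  finally show ?thesis by (simp add: algebra_simps)
qed

text \<open>Summing over time telescopes to the initial value of the convex functional, which is
  controlled by the total mass and the values of the test functions at \<open>M\<close>.\<close>

lemma total_energy:
  fixes N :: nat
  assumes steps: "\<And>n. n \<le> N \<Longrightarrow> 0 < \<tau> n \<and> step (\<tau> n) (u n) (v n) (u (n + 1)) (v (n + 1))"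
    and ini: "\<And>K. K \<in> S \<Longrightarrow> u 0 K \<in> {0..U} \<and> v 0 K \<in> {0..V}"
    and UV: "0 \<le> U" "0 \<le> V"
    and M: "\<beta> * U + \<alpha> * V \<le> \<alpha> * M" "\<beta> * U + \<alpha> * V \<le> \<beta> * M"
    and \<phi>: "\<And>x y. x \<in> {0..M} \<Longrightarrow> y \<in> {0..M} \<Longrightarrow> (x - y)\<^sup>2 \<le> (x - y) * (\<phi> x - \<phi> y)"
    and \<psi>: "\<And>x y. x \<in> {0..M} \<Longrightarrow> y \<in> {0..M} \<Longrightarrow> (x - y)\<^sup>2 \<le> (x - y) * (\<psi> x - \<psi> y)"
    and react: "\<And>x y. x \<in> {0..M} \<Longrightarrow> y \<in> {0..M} \<Longrightarrow> (rA x - rB y)\<^sup>2 \<le> (rA x - rB y) * (\<phi> x - \<psi> y)"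
    and zero: "0 \<le> \<phi> 0" "0 \<le> \<psi> 0"
  shows "(\<Sum>n=0..N. \<tau> n * (\<beta> * a / 2 * energy (u (n + 1)) + \<alpha> * b / 2 * energy (v (n + 1))
            + \<alpha> * \<beta> * k * (\<Sum>K\<in>S. m K * (rA (u (n + 1) K) - rB (v (n + 1) K))\<^sup>2)))
         \<le> (\<Sum>K\<in>S. m K) * (\<beta> * (\<phi> M * M) + \<alpha> * (\<psi> M * M))"
proof -
  have bd: "u n K \<in> {0..M}" "v n K \<in> {0..M}" if "n \<le> N + 1" "K \<in> S" for n K
  proof -
    have "0 \<le> u n K \<and> \<beta> * u n K \<le> \<beta> * M \<and> 0 \<le> v n K \<and> \<alpha> * v n K \<le> \<alpha> * M"
      using steps_bounded[OF steps ini UV that] M by force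
    then show "u n K \<in> {0..M}" "v n K \<in> {0..M}" using pos by auto
  qed
  have mono: "mono_on {0..M} f"
    if f: "\<And>x y. x \<in> {0..M} \<Longrightarrow> y \<in> {0..M} \<Longrightarrow> (x - y)\<^sup>2 \<le> (x - y) * (f x - f y)" for f
  proof (rule mono_onI)
    fix x y assume xy: "x \<in> {0..M}" "y \<in> {0..M}" "x \<le> y"
    have "0 \<le> (y - x) * (f y - f x)"
      using f[OF xy(2,1)] by (meson order_trans zero_le_power2)
    then show "f x \<le> f y" using xy(3) by (cases "x = y") (auto simp: zero_le_mult_iff)
  qed
  obtain \<Phi> where \<Phi>: "\<Phi> 0 = 0"
    "\<And>x y. x \<in> {0..M} \<Longrightarrow> y \<in> {0..M} \<Longrightarrow> \<Phi> y - \<Phi> x \<le> \<phi> y * (y - x)"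
    using mono_on_primitive[OF mono[OF \<phi>]] by blast
  obtain \<Psi> where \<Psi>: "\<Psi> 0 = 0"
    "\<And>x y. x \<in> {0..M} \<Longrightarrow> y \<in> {0..M} \<Longrightarrow> \<Psi> y - \<Psi> x \<le> \<psi> y * (y - x)"
    using mono_on_primitive[OF mono[OF \<psi>]] by blast
  \<comment> \<open>Since \<open>0 \<le> f 0\<close>, the subgradient inequality at 0 makes
    \<open>F\<close> nonnegative; the one at \<open>x\<close>, with monotonicity of
    \<open>f\<close>, gives the upper bound.\<close>
  have prim: "0 \<le> F x \<and> F x \<le> f M * M"
    if "mono_on {0..M} f" "0 \<le> f 0" "F 0 = 0" "x \<in> {0..M}"
      and F: "\<And>x y. x \<in> {0..M} \<Longrightarrow> y \<in> {0..M} \<Longrightarrow> F y - F x \<le> f y * (y - x)" for f F x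
  proof
    have "0 \<le> f 0 * x" using that by simp
    moreover have "F 0 - F x \<le> f 0 * (0 - x)" using that by (intro F) auto
    ultimately show "0 \<le> F x" using that(3) by simp
    have "f 0 \<le> f x" "f x \<le> f M" using that by (auto intro!: mono_onD[OF that(1)])
    then have "f x * x \<le> f M * M" using that(2,4) by (intro mult_mono) auto
    moreover have "F x - F 0 \<le> f x * (x - 0)" using that by (intro F) auto
    ultimately show "F x \<le> f M * M" using that(3) by simp
  qed
  define H where "H n = (\<Sum>K\<in>S. m K * (\<beta> * \<Phi> (u n K) + \<alpha> * \<Psi> (v n K)))" for n
  have "(\<Sum>n=0..N. \<tau> n * (\<beta> * a / 2 * energy (u (n + 1)) + \<alpha> * b / 2 * energy (v (n + 1))
            + \<alpha> * \<beta> * k * (\<Sum>K\<in>S. m K * (rA (u (n + 1) K) - rB (v (n + 1) K))\<^sup>2)))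
        \<le> (\<Sum>n=0..N. H n - H (Suc n))"
  proof (rule sum_mono)
    fix n assume "n \<in> {0..N}"
    then have n: "n \<le> N" "n \<le> N + 1" "n + 1 \<le> N + 1" by auto
    show "\<tau> n * (\<beta> * a / 2 * energy (u (n + 1)) + \<alpha> * b / 2 * energy (v (n + 1))
            + \<alpha> * \<beta> * k * (\<Sum>K\<in>S. m K * (rA (u (n + 1) K) - rB (v (n + 1) K))\<^sup>2)) \<le> H n - H (Suc n)"
      unfolding H_def Suc_eq_plus1 using steps[OF n(1)] bd[OF n(2)] bd[OF n(3)]
      by (intro step_energy[OF _ _ \<Phi>(2) \<Psi>(2) \<phi> \<psi> react]) blast+
  qed
  also have "\<dots> = H 0 - H (Suc N)"
    unfolding atLeast0AtMost by (rule sum_telescope)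
  also have "\<dots> \<le> H 0"
    unfolding H_def using m_pos pos prim[OF mono[OF \<phi>] zero(1) \<Phi>(1) _ \<Phi>(2)] bd[of "Suc N"]
      prim[OF mono[OF \<psi>] zero(2) \<Psi>(1) _ \<Psi>(2)]
    by (simp add: sum_nonneg less_imp_le)
  also have "\<dots> \<le> (\<Sum>K\<in>S. m K * (\<beta> * (\<phi> M * M) + \<alpha> * (\<psi> M * M)))"
    unfolding H_def using m_pos pos prim[OF mono[OF \<phi>] zero(1) \<Phi>(1) _ \<Phi>(2)] bd[of 0]
      prim[OF mono[OF \<psi>] zero(2) \<Psi>(1) _ \<Psi>(2)]
    by (intro sum_mono mult_left_mono add_mono) (auto simp: less_imp_le)
  finally show ?thesis by (simp add: sum_distrib_right)
qed

end

section \<open>Cell averages, transmissibilities and cell measures\<close>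

lemma cell_average_bounds:
  assumes "open \<Omega>" "K \<subseteq> \<Omega>" "K \<in> lmeasurable" "0 \<le> U"
    and "AE x in lebesgue_on \<Omega>. 0 \<le> f x \<and> f x \<le> U"
  shows "cell_average f K \<in> {0..U}"
proof -
  have "\<Omega> \<in> sets lebesgue" using \<open>open \<Omega>\<close> by simp
  then have ae: "AE x in lebesgue. x \<in> \<Omega> \<longrightarrow> 0 \<le> f x \<and> f x \<le> U"
    using assms(5) by (simp add: AE_restrict_space_iff imp_conjR)
  have "0 \<le> (LINT y:K|lebesgue. f y)"
    unfolding set_lebesgue_integral_def
    by (rule integral_nonneg_AE, use ae in eventually_elim)
       (use \<open>K \<subseteq> \<Omega>\<close> in \<open>auto simp: indicator_def\<close>)
  \<comment> \<open>The rule \<open>integral_mono_AE'\<close> asks for integrability of the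
    nonnegative upper bound alone; an integral that does not exist has the value 0.\<close>
  moreover have "(LINT y:K|lebesgue. f y) \<le> (LINT y:K|lebesgue. U)"
    unfolding set_lebesgue_integral_def
  proof (rule integral_mono_AE')
    show "integrable lebesgue (\<lambda>x. indicat_real K x *\<^sub>R U)"
      using \<open>K \<in> lmeasurable\<close> by (simp add: lmeasurable_iff_integrable)
  qed (use ae in \<open>eventually_elim; use \<open>K \<subseteq> \<Omega>\<close> \<open>0 \<le> U\<close> in \<open>auto simp: indicator_def\<close>\<close>)+
  moreover have "(LINT y:K|lebesgue. U) = U * measure lebesgue K"
    using \<open>K \<in> lmeasurable\<close> by (simp add: set_lebesgue_integral_def fmeasurable_def)
  \<comment> \<open>On a null set the average is 0, as division by zero gives 0, and this value lies
    in the interval too.\<close>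
  ultimately show ?thesis
    using \<open>0 \<le> U\<close> by (cases "measure lebesgue K = 0") (auto simp: cell_average_def field_simps zero_less_measure_iff)
qed

lemma edges_sym: "(K, L) \<in> edges \<M> \<longleftrightarrow> (L, K) \<in> edges \<M>"
  by (auto simp: edges_def interface_def Int_commute)

lemma transmissibility_sym: "transmissibility x K L = transmissibility x L K"
  by (simp add: transmissibility_def interface_def Int_commute dist_commute)

lemma transmissibility_nonneg: "(K, L) \<in> edges \<M> \<Longrightarrow> 0 \<le> transmissibility x K L"
  by (auto simp: edges_def transmissibility_def)

lemma measure_open_pos:
  assumes "open K" "bounded K" "K \<noteq> {}"
  shows "0 < measure lebesgue K"
  using assms lmeasurable_open[of K] open_not_negligible[of K] negligible_iff_measure[of K]
  by (simp add: zero_less_measure_iff)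

text \<open>Cells are disjoint subsets of the domain. This removes the mesh from the total mass in
  \<open>total_energy\<close>.\<close>

lemma admissible_mesh_measure:
  assumes "admissible_mesh \<Omega> \<M> x" "open \<Omega>" "bounded \<Omega>"
  shows "(\<Sum>K\<in>\<M>. measure lebesgue K) \<le> measure lebesgue \<Omega>"
proof -
  have M: "finite \<M>" "\<And>K. K \<in> \<M> \<Longrightarrow> open K \<and> bounded K \<and> K \<subseteq> \<Omega>" "disjoint \<M>"
    using assms(1) by (auto simp: admissible_mesh_def disjoint_def)
  have "(\<Sum>K\<in>\<M>. measure lebesgue K) = measure lebesgue (\<Union>\<M>)"
    using M by (intro measure_Union'[symmetric]) (auto intro: lmeasurable_open)
  also have "\<dots> \<le> measure lebesgue \<Omega>"
    using M assms by (intro measure_mono_fmeasurable) (auto intro!: lmeasurable_open)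
  finally show ?thesis .
qed

section \<open>The estimates for the finite volume scheme\<close>

theorem proposition5p1:
  fixes \<Omega> :: "(real^'n) set"
    and u0 v0 :: "real^'n \<Rightarrow> real"
    and U V \<alpha> \<beta> a b T :: real
    and rA rB :: "real \<Rightarrow> real"
  assumes "CARD('n) \<in> {1, 2, 3}"
    and "open \<Omega>" and "connected \<Omega>" and "bounded \<Omega>" and "smooth_boundary \<Omega>"
    and "u0 \<in> L_infty \<Omega>" and "v0 \<in> L_infty \<Omega>"
    and "0 < U" and "0 < V"
    and "AE x in lebesgue_on \<Omega>. 0 \<le> u0 x \<and> u0 x \<le> U"
    and "AE x in lebesgue_on \<Omega>. 0 \<le> v0 x \<and> v0 x \<le> V"
    and "0 < \<alpha>" and "0 < \<beta>" and "0 < a" and "0 < b"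
    and "rA C1_differentiable_on UNIV" and "rB C1_differentiable_on UNIV"
    and "strict_mono rA" and "strict_mono rB"
    and "rA 0 = 0" and "rB 0 = 0"
    and "rA ` {0..} \<subseteq> rB ` {0..}"
    and "0 < T"
    and "\<And>s. 0 < s \<Longrightarrow> 0 < deriv rA s" and "\<And>s. 0 < s \<Longrightarrow> 0 < deriv rB s"
    and "Limsup (at_right 0) (\<lambda>s. ereal (s * deriv rA s / rA s)) < \<infinity>"
    and "Limsup (at_right 0) (\<lambda>s. ereal (s * deriv rB s / rB s)) < \<infinity>"
  shows "\<exists>C>0. \<forall>k>0. \<forall>\<M> x N t u v.
     fv_discretization \<Omega> T \<M> x N t \<longrightarrow>
     (\<forall>K\<in>\<M>. u 0 K = cell_average u0 K \<and> v 0 K = cell_average v0 K) \<longrightarrow>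
     fv_scheme a b (k * \<alpha>) (k * \<beta>) rA rB \<M> x N t u v \<longrightarrow>
       (\<Sum>n=0..N. (t (n + 1) - t n) *
          ((\<Sum>(K, L)\<in>edges \<M>. transmissibility x K L * (u (n + 1) L - u (n + 1) K)\<^sup>2)
         + (\<Sum>(K, L)\<in>edges \<M>. transmissibility x K L * (v (n + 1) L - v (n + 1) K)\<^sup>2))) \<le> C
     \<and> k * (\<Sum>n=0..N. (t (n + 1) - t n) *
          (\<Sum>K\<in>\<M>. measure lebesgue K * (rA (u (n + 1) K) - rB (v (n + 1) K))\<^sup>2)) \<le> C"
proof -
  define c where "c = \<beta> * U + \<alpha> * V"
  \<comment> \<open>\<open>c / \<beta>\<close> bounds \<open>u\<close> and
    \<open>c / \<alpha>\<close> bounds \<open>v\<close>; the sum serves for both. This and the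
    constants below are fixed before \<open>k\<close> and the discretization.\<close>
  define M where "M = c / \<alpha> + c / \<beta>"
  have c: "0 \<le> c" using assms(8,9,12,13) by (simp add: c_def)
  then have M: "0 \<le> M" "c \<le> \<alpha> * M" "c \<le> \<beta> * M"
    using assms(12,13) by (auto simp: M_def field_simps)
  obtain \<phi> \<psi> where test:
    "\<And>x y. x \<in> {0..M} \<Longrightarrow> y \<in> {0..M} \<Longrightarrow> (x - y)\<^sup>2 \<le> (x - y) * (\<phi> x - \<phi> y)"
    "\<And>x y. x \<in> {0..M} \<Longrightarrow> y \<in> {0..M} \<Longrightarrow> (x - y)\<^sup>2 \<le> (x - y) * (\<psi> x - \<psi> y)"
    "\<And>x y. x \<in> {0..M} \<Longrightarrow> y \<in> {0..M} \<Longrightarrow> (rA x - rB y)\<^sup>2 \<le> (rA x - rB y) * (\<phi> x - \<psi> y)"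
    "0 \<le> \<phi> 0" "0 \<le> \<psi> 0"
    using test_functions[OF assms(18-21) M(1)] by blast
  \<comment> \<open>The absolute value makes the factor visibly nonnegative, as needed to replace
    the total cell measure by that of the domain.\<close>
  define B where "B = \<bar>\<beta> * (\<phi> M * M) + \<alpha> * (\<psi> M * M)\<bar>"
  define G where "G = measure lebesgue \<Omega> * B"
  \<comment> \<open>The smallest coefficient on the left of the energy estimate, with the factor
    \<open>k\<close> kept apart.\<close>
  define \<kappa> where "\<kappa> = min (\<beta> * a / 2) (min (\<alpha> * b / 2) (\<alpha> * \<beta>))"
  have \<kappa>: "0 < \<kappa>" "\<kappa> \<le> \<beta> * a / 2" "\<kappa> \<le> \<alpha> * b / 2" "\<kappa> \<le> \<alpha> * \<beta>"
    using assms(12-15) by (auto simp: \<kappa>_def)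
  have G: "0 \<le> G" by (simp add: G_def B_def)
  show ?thesis
  \<comment> \<open>The summand 1 only ensures strict positivity of the constant.\<close>
  proof (intro exI[of _ "G / \<kappa> + 1"] conjI allI impI)
    show "0 < G / \<kappa> + 1" using G \<kappa>(1) by (simp add: add_nonneg_pos)
    fix k :: real and \<M> and x :: "(real^'n) set \<Rightarrow> real^'n" and N t u v
    assume k: "0 < k" and disc: "fv_discretization \<Omega> T \<M> x N t"
      and ini: "\<forall>K\<in>\<M>. u 0 K = cell_average u0 K \<and> v 0 K = cell_average v0 K"
      and scheme: "fv_scheme a b (k * \<alpha>) (k * \<beta>) rA rB \<M> x N t u v"
    have mesh: "admissible_mesh \<Omega> \<M> x" and time: "\<And>n. n \<le> N \<Longrightarrow> t n < t (n + 1)"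
      using disc by (auto simp: fv_discretization_def time_discretization_def)
    then have fin: "finite \<M>"
      and cell: "\<And>K. K \<in> \<M> \<Longrightarrow> open K \<and> bounded K \<and> K \<subseteq> \<Omega> \<and> x K \<in> K"
      by (auto simp: admissible_mesh_def)
    define w where "w K L = (if (K, L) \<in> edges \<M> then transmissibility x K L else 0)" for K L
    interpret reaction_diffusion \<M> "measure lebesgue" w a b k \<alpha> \<beta> rA rB
    proof
      show "0 < measure lebesgue K" if "K \<in> \<M>" for K
        using cell[OF that] by (intro measure_open_pos) auto
      show "continuous_on UNIV rA" "continuous_on UNIV rB"
        using assms(16,17) C1_differentiable_imp_continuous_on by auto
    qed (use assms k fin edges_sym[of _ _ \<M>] transmissibility_sym transmissibility_nonneg
          in \<open>auto simp: w_def\<close>)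
    have edges_sub: "edges \<M> \<subseteq> \<M> \<times> \<M>" by (auto simp: edges_def)
    have edges_sum: "(\<Sum>(K, L)\<in>edges \<M>. transmissibility x K L * (z L - z K)\<^sup>2) = energy z" for z
    proof -
      have "energy z = (\<Sum>(K, L)\<in>\<M> \<times> \<M>. w K L * (z L - z K)\<^sup>2)"
        by (simp add: energy_def sum.cartesian_product)
      also have "\<dots> = (\<Sum>(K, L)\<in>edges \<M>. transmissibility x K L * (z L - z K)\<^sup>2)"
        using fin edges_sub by (intro sum.mono_neutral_cong_right) (auto simp: w_def)
      finally show ?thesis by simp
    qed
    have nbr_sum: "(\<Sum>L\<in>neighbours \<M> K. transmissibility x K L * (z L - z K)) =
        (\<Sum>L\<in>\<M>. w K L * (z L - z K))" for z K
      using fin by (intro sum.mono_neutral_cong_left) (auto simp: w_def neighbours_def)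
    define \<tau> where "\<tau> n = t (n + 1) - t n" for n
    have steps: "0 < \<tau> n \<and> step (\<tau> n) (u n) (v n) (u (n + 1)) (v (n + 1))" if "n \<le> N" for n
      using scheme time[OF that] that unfolding fv_scheme_def step_def \<tau>_def nbr_sum by auto
    have init: "u 0 K \<in> {0..U} \<and> v 0 K \<in> {0..V}" if "K \<in> \<M>" for K
      using ini that cell[OF that] assms(2,8-11)
      by (auto simp only: intro!: cell_average_bounds[of \<Omega>] lmeasurable_open less_imp_le)
    define E where "E n = energy (u (n + 1)) + energy (v (n + 1))" for n
    define R where "R n = (\<Sum>K\<in>\<M>. measure lebesgue K * (rA (u (n + 1) K) - rB (v (n + 1) K))\<^sup>2)" for n
    have energy_nonneg: "0 \<le> energy z" for z
      unfolding energy_def by (intro sum_nonneg mult_nonneg_nonneg w_nonneg) auto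
    have R_nonneg: "0 \<le> R n" for n
      unfolding R_def by (intro sum_nonneg) auto
    have "\<kappa> * (\<Sum>n=0..N. \<tau> n * (E n + k * R n)) =
        (\<Sum>n=0..N. \<tau> n * (\<kappa> * energy (u (n + 1)) + \<kappa> * energy (v (n + 1)) + \<kappa> * (k * R n)))"
      by (simp add: sum_distrib_left E_def algebra_simps)
    also have "\<dots> \<le> (\<Sum>n=0..N. \<tau> n * (\<beta> * a / 2 * energy (u (n + 1)) + \<alpha> * b / 2 * energy (v (n + 1))
            + \<alpha> * \<beta> * (k * R n)))"
      using steps \<kappa> energy_nonneg R_nonneg k
      by (intro sum_mono mult_left_mono add_mono mult_right_mono) (auto simp: less_imp_le)
    also have "\<dots> \<le> (\<Sum>K\<in>\<M>. measure lebesgue K) * (\<beta> * (\<phi> M * M) + \<alpha> * (\<psi> M * M))"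
      using total_energy[OF steps init _ _ M(2,3)[unfolded c_def] test] assms(8,9)
      by (simp add: R_def mult.assoc)
    also have "\<dots> \<le> measure lebesgue \<Omega> * B"
      unfolding B_def using admissible_mesh_measure[OF mesh assms(2,4)]
      by (intro order_trans[OF mult_left_mono[OF abs_ge_self] mult_right_mono]) (auto intro: sum_nonneg)
    finally have total: "(\<Sum>n=0..N. \<tau> n * (E n + k * R n)) \<le> G / \<kappa>"
      using \<kappa>(1) by (simp add: G_def field_simps)
    have "(\<Sum>n=0..N. \<tau> n * (E n + k * R n)) = (\<Sum>n=0..N. \<tau> n * E n) + k * (\<Sum>n=0..N. \<tau> n * R n)"
      by (simp add: sum.distrib sum_distrib_left algebra_simps)
    \<comment> \<open>Both parts of the total are nonnegative, so each inherits its bound.\<close>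
    moreover have "0 \<le> (\<Sum>n=0..N. \<tau> n * E n)" "0 \<le> k * (\<Sum>n=0..N. \<tau> n * R n)"
      using steps k R_nonneg energy_nonneg
      by (auto intro!: sum_nonneg mult_nonneg_nonneg simp: E_def less_imp_le)
    ultimately have "(\<Sum>n=0..N. \<tau> n * E n) \<le> G / \<kappa> + 1" "k * (\<Sum>n=0..N. \<tau> n * R n) \<le> G / \<kappa> + 1"
      using total by linarith+
    then show "(\<Sum>n=0..N. (t (n + 1) - t n) *
          ((\<Sum>(K, L)\<in>edges \<M>. transmissibility x K L * (u (n + 1) L - u (n + 1) K)\<^sup>2)
         + (\<Sum>(K, L)\<in>edges \<M>. transmissibility x K L * (v (n + 1) L - v (n + 1) K)\<^sup>2))) \<le> G / \<kappa> + 1"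
      "k * (\<Sum>n=0..N. (t (n + 1) - t n) *
          (\<Sum>K\<in>\<M>. measure lebesgue K * (rA (u (n + 1) K) - rB (v (n + 1) K))\<^sup>2)) \<le> G / \<kappa> + 1"
      by (simp_all add: edges_sum E_def R_def \<tau>_def)
  qed
qed

end
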